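(* Let $k\ge1$ and $0\le t\le k$ be integers. Then $$\mathrm{Card}\big(\{d\in A_k : \mathrm{pn}(d)=t\}\big)=\sum_{\lambda\in\Gamma_k,\ |\lambda|=t}(m_k^\lambda)^2 .$$
   Context: $A_k$ is the set of set partitions of $\{1,\ldots,k,1',\ldots,k'\}$. The propagating number $\mathrm{pn}(d)$ is the number of blocks of $d$ containing both an element of $\{1,\ldots,k\}$ and an element of $\{1',\ldots,k'\}$. $\Gamma_k$ is the set of all integer partitions $\lambda$ with $0\le|\lambda|\le k$, identified with Young diagrams. $m_k^\lambda$ is the number of vacillating tableaux of shape $\lambda$ and length $2k$, i.e. of sequences of partitions $(\emptyset=\lambda^{(0)},\lambda^{(1/2)},\lambda^{(1)},\ldots,\lambda^{(k-1/2)},\lambda^{(k)}=\lambda)$ such that for each integer $0\le i\le k-1$: $\lambda^{(i+1/2)}$ equals $\lambda^{(i)}$ or is obtained from it by removing one box; and $\lambda^{(i+1)}$ equals $\lambda^{(i+1/2)}$ or is obtained from it by adding one box. *)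

theory Defs
  imports Main "HOL-Library.Disjoint_Sets"
begin

text \<open>The elements \<open>i\<close> and \<open>i'\<close> are encoded as \<open>Inl i\<close> and \<open>Inr i\<close>.\<close>

definition partition_diagrams :: "nat \<Rightarrow> (nat + nat) set set set" where
  "partition_diagrams k = {d. partition_on ({1..k} <+> {1..k}) d}"

definition pn :: "nat \<Rightarrow> (nat + nat) set set \<Rightarrow> nat" where
  "pn k d = card {B \<in> d. B \<inter> Inl ` {1..k} \<noteq> {} \<and> B \<inter> Inr ` {1..k} \<noteq> {}}"

text \<open>Integer partitions are weakly decreasing lists of positive parts; the empty partition is
  the empty list.\<close>

definition is_int_partition :: "nat list \<Rightarrow> bool" where
  "is_int_partition \<nu> \<longleftrightarrow> sorted_wrt (\<ge>) \<nu> \<and> (\<forall>p \<in> set \<nu>. p > 0)"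

definition young_diagram :: "nat list \<Rightarrow> (nat \<times> nat) set" where
  "young_diagram \<nu> = {(i, j). i < length \<nu> \<and> j < \<nu> ! i}"

definition removes_box :: "nat list \<Rightarrow> nat list \<Rightarrow> bool" where
  "removes_box \<nu> \<mu> \<longleftrightarrow> (\<exists>b \<in> young_diagram \<nu>. young_diagram \<mu> = young_diagram \<nu> - {b})"

definition adds_box :: "nat list \<Rightarrow> nat list \<Rightarrow> bool" where
  "adds_box \<nu> \<mu> \<longleftrightarrow> (\<exists>b. b \<notin> young_diagram \<nu> \<and> young_diagram \<mu> = insert b (young_diagram \<nu>))"

definition \<Gamma> :: "nat \<Rightarrow> nat list set" where
  "\<Gamma> k = {\<nu>. is_int_partition \<nu> \<and> sum_list \<nu> \<le> k}"

text \<open>A tableau of length \<open>2k\<close> is a list of \<open>2k + 1\<close> partitions, with \<open>\<nu>\<close> at level \<open>i\<close> stored at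
  position \<open>2i\<close> and \<open>\<nu>\<close> at level \<open>i + 1/2\<close> stored at position \<open>2i + 1\<close>.\<close>

definition vacillating_tableaux :: "nat \<Rightarrow> nat list \<Rightarrow> nat list list set" where
  "vacillating_tableaux k \<nu> =
    {T. length T = 2 * k + 1 \<and> (\<forall>\<mu> \<in> set T. is_int_partition \<mu>) \<and>
        T ! 0 = [] \<and> T ! (2 * k) = \<nu> \<and>
        (\<forall>i<k. (T ! (2 * i + 1) = T ! (2 * i) \<or> removes_box (T ! (2 * i)) (T ! (2 * i + 1))) \<and>
               (T ! (2 * i + 2) = T ! (2 * i + 1) \<or> adds_box (T ! (2 * i + 1)) (T ! (2 * i + 2))))}"

definition num_vacillating :: "nat \<Rightarrow> nat list \<Rightarrow> nat" where
  "num_vacillating k \<nu> = card (vacillating_tableaux k \<nu>)"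

end

theory Submission
  imports Defs "HOL-Combinatorics.Stirling"
begin

text \<open>Let \<open>W(k,t)\<close> be the number of set partitions of a \<open>k\<close>-set with \<open>t\<close> marked blocks. A diagram with
  propagating number \<open>t\<close> amounts to such a marked partition of each row together with a bijection
  between the marked blocks, so there are \<open>t! W(k,t)\<^sup>2\<close> of them.

  On the other side, let \<open>U\<close> and \<open>D\<close> be the operators adding and removing a box. Since
  \<open>DU = UD + 1\<close>, we have \<open>D U\<^sup>n \<emptyset> = n U\<^sup>n\<^sup>-\<^sup>1 \<emptyset>\<close>, and the recursion for \<open>W\<close> shows that
  \<open>((1 + U)(1 + D))\<^sup>k \<emptyset>\<close> is the sum of \<open>W(k,t) U\<^sup>t \<emptyset>\<close> over \<open>t\<close>. Hence
  \<open>m\<^sub>k = W(k,t) f\<close> on shapes of size \<open>t\<close>, where \<open>f\<close> counts standard tableaux, and the squares of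
  \<open>f\<close> over these shapes add up to \<open>t!\<close>.\<close>

section \<open>Set partitions by crossing blocks\<close>

definition set_partitions :: "'a set \<Rightarrow> 'a set set set" where
  "set_partitions A = {P. partition_on A P}"

lemma finite_set_partitions: "finite A \<Longrightarrow> finite (set_partitions A)"
  unfolding set_partitions_def by (rule finitely_many_partition_on)

lemma partition_on_insert_element:
  assumes "partition_on A P" "C \<in> insert {} P" "x \<notin> A"
  shows "partition_on (insert x A) (insert (insert x C) (P - {C}))"
  using assms unfolding partition_on_def disjoint_def by auto

text \<open>Discarding the empty set covers the case \<open>B = {x}\<close>, where deleting
  \<open>x\<close> makes the whole block disappear.\<close>

lemma partition_on_remove_element:
  assumes "partition_on (insert x A) Q" "B \<in> Q" "x \<in> B" "x \<notin> A"
  shows "partition_on A (insert (B - {x}) (Q - {B}) - {{}})"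
proof -
  have u: "D = B" if "D \<in> Q" "x \<in> D" for D
    using assms that by (auto simp: partition_on_def disjoint_def)
  have "\<Union>(insert (B - {x}) (Q - {B}) - {{}}) = \<Union>Q - {x}"
    using assms u by blast
  then have "\<Union>(insert (B - {x}) (Q - {B}) - {{}}) = A"
    using assms(1,4) by (auto simp: partition_on_def)
  moreover have "disjoint (insert (B - {x}) (Q - {B}))"
    using assms(1,2) by (auto simp: partition_on_def disjoint_def)
  then have "disjoint (insert (B - {x}) (Q - {B}) - {{}})" by (rule pairwise_subset) auto
  ultimately show ?thesis by (simp add: partition_on_def)
qed

text \<open>The empty block stands for the choice of making \<open>x\<close> a block of its own.\<close>

lemma sum_set_partitions_insert:
  fixes h :: "'a set set \<Rightarrow> nat"
  assumes "finite A" "x \<notin> A"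
  shows "sum h (set_partitions (insert x A)) =
    (\<Sum>P \<in> set_partitions A. \<Sum>C \<in> insert {} P. h (insert (insert x C) (P - {C})))"
proof -
  \<comment> \<open>Exactly one block contains \<open>x\<close>, so this union is that block itself
    and no choice operator is needed.\<close>
  define block where "block Q = \<Union>{B \<in> Q. x \<in> B}" for Q :: "'a set set"
  have fin: "\<forall>P \<in> set_partitions A. finite (insert {} P)"
    using assms(1) by (auto simp: set_partitions_def intro: finite_elements)
  have block: "block Q \<in> Q \<and> x \<in> block Q" if "partition_on (insert x A) Q" for Q
  proof -
    from that have "x \<in> \<Union>Q" by (auto simp: partition_on_def)
    then obtain B where B: "B \<in> Q" "x \<in> B" by blast
    then have "{B \<in> Q. x \<in> B} = {B}"
      using that by (auto simp: partition_on_def disjoint_def)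
    with B show ?thesis by (simp add: block_def)
  qed
  have block_ins: "block (insert (insert x C) (P - {C})) = insert x C"
    if "partition_on A P" for P C
  proof -
    have "x \<notin> B" if "B \<in> P" for B
      using \<open>partition_on A P\<close> that assms(2) by (auto simp: partition_on_def)
    then have "{B \<in> insert (insert x C) (P - {C}). x \<in> B} = {insert x C}" by auto
    then show ?thesis by (simp add: block_def)
  qed
  have "sum h (set_partitions (insert x A)) =
    (\<Sum>(P, C) \<in> Sigma (set_partitions A) (insert {}). h (insert (insert x C) (P - {C})))"
  proof (rule sum.reindex_bij_witness[where
        i = "\<lambda>(P, C). insert (insert x C) (P - {C})" and
        j = "\<lambda>Q. (insert (block Q - {x}) (Q - {block Q}) - {{}}, block Q - {x})"])
    fix Q assume "Q \<in> set_partitions (insert x A)"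
    then have Q: "partition_on (insert x A) Q" by (simp add: set_partitions_def)
    note b = block[OF Q]
    have ne: "{} \<notin> Q" using Q by (rule partition_onD3)
    \<comment> \<open>If this set were in \<open>Q\<close>, it would be a block disjoint from
      \<open>block Q\<close> yet contained in it, hence empty. Therefore removing
      \<open>C = block Q - {x}\<close> during reinsertion does not delete another block.\<close>
    have nb: "block Q - {x} \<notin> Q"
      using Q b ne by (metis DiffD1 DiffD2 disjointD equals0I inf.idem inf_commute
          insertCI partition_onD2 Diff_subset inf.absorb_iff2)
    show "(case (insert (block Q - {x}) (Q - {block Q}) - {{}}, block Q - {x}) of
        (P, C) \<Rightarrow> insert (insert x C) (P - {C})) = Q"
      using b ne nb by (auto simp: insert_absorb)
    then show "(case (insert (block Q - {x}) (Q - {block Q}) - {{}}, block Q - {x}) of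
        (P, C) \<Rightarrow> h (insert (insert x C) (P - {C}))) = h Q" by simp
    show "(insert (block Q - {x}) (Q - {block Q}) - {{}}, block Q - {x})
        \<in> Sigma (set_partitions A) (insert {})"
      using partition_on_remove_element[OF Q] b assms(2) by (auto simp: set_partitions_def)
  next
    fix PC :: "'a set set \<times> 'a set" assume "PC \<in> Sigma (set_partitions A) (insert {})"
    then obtain P C where PC: "PC = (P, C)" and P: "partition_on A P" and C: "C \<in> insert {} P"
      by (auto simp: set_partitions_def)
    have xC: "x \<notin> C" and new: "insert x C \<notin> P"
      using P C assms(2) by (auto simp: partition_on_def)
    have ne: "{} \<notin> P" using P by (rule partition_onD3)
    let ?Q = "insert (insert x C) (P - {C})"
    let ?I = "\<lambda>(P, C). insert (insert x C) (P - {C})"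
    show "?I PC \<in> set_partitions (insert x A)"
      using partition_on_insert_element[OF P C assms(2)] by (simp add: PC set_partitions_def)
    have "insert x C - {x} = C" using xC by auto
    moreover have "insert C (?Q - {insert x C}) - {{}} = P" using new ne C by auto
    ultimately show "(insert (block (?I PC) - {x})
        (?I PC - {block (?I PC)}) - {{}},
        block (?I PC) - {x}) = PC"
      by (simp add: PC block_ins[OF P])
  qed
  also have "\<dots> = (\<Sum>P \<in> set_partitions A. \<Sum>C \<in> insert {} P. h (insert (insert x C) (P - {C})))"
    using finite_set_partitions[OF assms(1)] fin by (simp add: sum.Sigma)
  finally show ?thesis .
qed

text \<open>Only the contribution of \<open>C\<close> is exchanged for that of
  \<open>insert x C\<close>; placing the corrections on both sides avoids truncated subtraction. Two
  predicates are used because a property such as meeting \<open>A\<close> changes when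
  \<open>x\<close> joins \<open>A\<close>. The choice \<open>C = {}\<close> removes no block, so
  \<open>R\<close> has to fail on \<open>{}\<close>.\<close>

lemma card_blocks_insert_element:
  assumes "partition_on A P" "C \<in> insert {} P" "x \<notin> A" "finite P"
    and R': "\<And>D. D \<in> P \<Longrightarrow> R' D = R D" and "\<not> R {}"
  shows "card {D \<in> insert (insert x C) (P - {C}). R' D} + of_bool (R C) =
    card {D \<in> P. R D} + of_bool (R' (insert x C))"
proof -
  have new: "insert x C \<notin> P" and ne: "{} \<notin> P"
    using assms(1-3) by (auto simp: partition_on_def)
  let ?S = "{D \<in> P - {C}. R D}"
  have S: "finite ?S" "insert x C \<notin> ?S" "C \<notin> ?S" using assms(4) new by auto
  have "{D \<in> insert (insert x C) (P - {C}). R' D} =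
      (if R' (insert x C) then insert (insert x C) ?S else ?S)"
    using R' by auto
  moreover have "{D \<in> P. R D} = (if R C then insert C ?S else ?S)"
    using assms(2,6) by auto
  ultimately show ?thesis using S by simp
qed

section \<open>Blocks crossing between two disjoint sets, and marked blocks\<close>

definition meeting :: "'a set \<Rightarrow> 'a set set \<Rightarrow> nat" where
  "meeting X P = card {D \<in> P. D \<inter> X \<noteq> {}}"

text \<open>With the two rows of a diagram as \<open>X\<close> and \<open>Y\<close> this is the
  propagating number.\<close>

definition crossing :: "'a set \<Rightarrow> 'a set \<Rightarrow> 'a set set \<Rightarrow> nat" where
  "crossing X Y P = card {D \<in> P. D \<inter> X \<noteq> {} \<and> D \<inter> Y \<noteq> {}}"

text \<open>A new element either forms a block of its own or joins one of the existing blocks, which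
  is the recurrence of the Stirling numbers.\<close>

lemma card_set_partitions_Stirling:
  assumes "finite B"
  shows "card {P \<in> set_partitions B. card P = j} = Stirling (card B) j"
proof -
  \<comment> \<open>A cardinality written as a sum of indicators fits
    \<open>sum_set_partitions_insert\<close>.\<close>
  have "(\<Sum>P \<in> set_partitions B. of_bool (card P = j)) = Stirling (card B) j"
    using assms
  proof (induction B arbitrary: j)
    case empty
    then show ?case by (cases j) (auto simp: set_partitions_def partition_on_empty)
  next
    case (insert x B)
    have fin: "finite P" "{} \<notin> P" if "P \<in> set_partitions B" for P
      using that finite_elements[OF insert.hyps(1)] by (auto simp: set_partitions_def partition_on_def)
    have c: "card (insert (insert x C) (P - {C})) = card P"
      if "P \<in> set_partitions B" "C \<in> P" for P C
    proof -
      have "insert x C \<notin> P" using that insert.hyps(2) by (auto simp: set_partitions_def partition_on_def)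
      then show ?thesis using fin(1)[OF that(1)] that(2)
        by (simp add: card_insert_if card_Diff_singleton) (metis Suc_pred card_gt_0_iff empty_iff)
    qed
    have c0: "card (insert {x} (P - {{}})) = Suc (card P)"
      if "P \<in> set_partitions B" for P
    proof -
      have "{x} \<notin> P" using that insert.hyps(2) by (auto simp: set_partitions_def partition_on_def)
      then show ?thesis using fin[OF that] by simp
    qed
    have "(\<Sum>P \<in> set_partitions (insert x B). of_bool (card P = j)) =
      (\<Sum>P \<in> set_partitions B. of_bool (Suc (card P) = j) + j * of_bool (card P = j))"
      unfolding sum_set_partitions_insert[OF insert.hyps(1,2)]
    proof (rule sum.cong[OF refl])
      fix P assume P: "P \<in> set_partitions B"
      have "(\<Sum>C\<in>P. of_bool (card (insert (insert x C) (P - {C})) = j) :: nat) =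
          (\<Sum>C\<in>P. of_bool (card P = j))"
        using c[OF P] by (intro sum.cong) auto
      then show "(\<Sum>C\<in>insert {} P. of_bool (card (insert (insert x C) (P - {C})) = j)) =
           of_bool (Suc (card P) = j) + j * of_bool (card P = j)"
        using fin[OF P] c0[OF P] by simp
    qed
    also have "\<dots> = Stirling (card (insert x B)) j"
      using insert.hyps insert.IH
      by (cases j) (simp_all add: sum.distrib flip: sum_distrib_left)
    finally show ?case .
  qed
  then show ?thesis using finite_set_partitions[OF assms]
    by (simp add: of_bool_def sum.If_cases Int_def)
qed

text \<open>Restricting \<open>P\<close> to \<open>A\<close> and \<open>B\<close> gives partitions
  into \<open>i\<close> and \<open>j\<close> blocks; \<open>P\<close> is recovered by choosing
  \<open>t\<close> blocks on each side and one of the \<open>t!\<close> ways to glue them. The proof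
  verifies this count by induction on \<open>A\<close>, following the three block numbers as one
  element is inserted.\<close>

lemma card_partitions_by_crossing:
  assumes "finite A" "finite B" "A \<inter> B = {}"
  shows "card {P \<in> set_partitions (A \<union> B). meeting A P = i \<and> meeting B P = j \<and> crossing A B P = t} =
    Stirling (card A) i * Stirling (card B) j * ((i choose t) * (j choose t) * fact t)"
proof -
  have "(\<Sum>P \<in> set_partitions (A \<union> B). of_bool (meeting A P = i \<and> meeting B P = j \<and> crossing A B P = t)) =
    Stirling (card A) i * Stirling (card B) j * ((i choose t) * (j choose t) * fact t)"
    using assms(1,3)
  proof (induction A arbitrary: i t)
    case empty
    have m: "meeting B P = card P" if "P \<in> set_partitions B" for P
    proof -
      have "D \<inter> B = D \<and> D \<noteq> {}" if "D \<in> P" for D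
        using that \<open>P \<in> set_partitions B\<close> by (auto simp: set_partitions_def partition_on_def)
      then have "{D \<in> P. D \<inter> B \<noteq> {}} = P" by auto
      then show ?thesis by (simp add: meeting_def)
    qed
    have "(\<Sum>P \<in> set_partitions B. of_bool (meeting {} P = i \<and> meeting B P = j \<and> crossing {} B P = t) :: nat) =
       (\<Sum>P \<in> set_partitions B. of_bool (i = 0 \<and> t = 0) * of_bool (card P = j))"
      by (intro sum.cong) (simp_all add: m, auto simp: meeting_def crossing_def)
    also have "\<dots> = of_bool (i = 0 \<and> t = 0) * Stirling (card B) j"
      using card_set_partitions_Stirling[OF assms(2), of j] finite_set_partitions[OF assms(2)]
      by (simp add: of_bool_def sum.If_cases Int_def flip: sum_distrib_left)
    finally show ?case by (cases i; cases t) auto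
  next
    case (insert x A)
    let ?U = "A \<union> B"
    let ?N = "\<lambda>i j t P. of_bool (meeting A P = i \<and> meeting B P = j \<and> crossing A B P = t) :: nat"
    have U: "finite ?U" "x \<notin> ?U" using insert assms by auto
    have dis: "A \<inter> B = {}" using insert by auto
    \<comment> \<open>The three terms: \<open>x\<close> is a new block, \<open>x\<close> joins one
      of the \<open>i\<close> blocks meeting \<open>A\<close>, or \<open>x\<close> joins a block
      inside \<open>B\<close>, which raises both the \<open>A\<close> count and the crossing number.
      In the last case there are \<open>j - (t - 1)\<close> such blocks, written
      \<open>Suc j - t\<close>. The indicators guard the predecessors at \<open>0\<close>.\<close>
    have "(\<Sum>P \<in> set_partitions (insert x A \<union> B).
        of_bool (meeting (insert x A) P = i \<and> meeting B P = j \<and> crossing (insert x A) B P = t)) =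
      (\<Sum>P \<in> set_partitions ?U.
        of_bool (i > 0) * ?N (i - 1) j t P + i * ?N i j t P +
        of_bool (i > 0 \<and> t > 0) * (Suc j - t) * ?N (i - 1) j (t - 1) P)"
      unfolding Un_insert_left sum_set_partitions_insert[OF U]
    proof (rule sum.cong[OF refl])
      fix P assume "P \<in> set_partitions ?U"
      then have P: "partition_on ?U P" by (simp add: set_partitions_def)
      have fP: "finite P" and ne: "{} \<notin> P"
        using finite_elements[OF U(1) P] P by (auto dest: partition_onD3)
      have xP: "x \<notin> D" if "D \<in> P" for D
        using that P U by (auto simp: partition_on_def)
      let ?Q = "\<lambda>C. insert (insert x C) (P - {C})"
      have A: "meeting (insert x A) (?Q C) = meeting A P + of_bool (C \<inter> A = {})"
        and B: "meeting B (?Q C) = meeting B P"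
        and AB: "crossing (insert x A) B (?Q C) = crossing A B P + of_bool (C \<inter> A = {} \<and> C \<inter> B \<noteq> {})"
        if C: "C \<in> insert {} P" for C
      proof -
        have R: "(D \<inter> insert x A \<noteq> {}) = (D \<inter> A \<noteq> {})" "(insert x D \<inter> B \<noteq> {}) = (D \<inter> B \<noteq> {})"
          if "D \<in> insert {} P" for D using that xP U by auto
        note ins = card_blocks_insert_element[OF P C U(2) fP]
        show "meeting (insert x A) (?Q C) = meeting A P + of_bool (C \<inter> A = {})"
          using ins[of "\<lambda>D. D \<inter> insert x A \<noteq> {}" "\<lambda>D. D \<inter> A \<noteq> {}"] R
          unfolding meeting_def by (cases "C \<inter> A = {}") simp_all
        show "meeting B (?Q C) = meeting B P"
          using ins[of "\<lambda>D. D \<inter> B \<noteq> {}" "\<lambda>D. D \<inter> B \<noteq> {}"] U(2)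
          unfolding meeting_def by simp
        show "crossing (insert x A) B (?Q C) = crossing A B P + of_bool (C \<inter> A = {} \<and> C \<inter> B \<noteq> {})"
          using ins[of "\<lambda>D. D \<inter> insert x A \<noteq> {} \<and> D \<inter> B \<noteq> {}" "\<lambda>D. D \<inter> A \<noteq> {} \<and> D \<inter> B \<noteq> {}"]
            R U(2)
          unfolding crossing_def by (cases "C \<inter> A = {}"; cases "C \<inter> B = {}") simp_all
      qed
      let ?h = "\<lambda>C. of_bool (meeting (insert x A) (?Q C) = i \<and> meeting B (?Q C) = j \<and>
          crossing (insert x A) B (?Q C) = t) :: nat"
      let ?PA = "{D \<in> P. D \<inter> A \<noteq> {}}" and ?PB = "{D \<in> P. D \<inter> A = {}}"
      have meetB: "D \<inter> B \<noteq> {}" if "D \<in> ?PB" for D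
      proof -
        have "D \<subseteq> A \<union> B" "D \<noteq> {}" "D \<inter> A = {}" using that partition_onD1[OF P] ne by auto
        then show ?thesis by blast
      qed
      \<comment> \<open>The blocks avoiding \<open>A\<close> are exactly those that meet
        \<open>B\<close> without crossing, so their number is a difference of the two
        statistics.\<close>
      have "{D \<in> P. D \<inter> B \<noteq> {}} = {D \<in> P. D \<inter> A \<noteq> {} \<and> D \<inter> B \<noteq> {}} \<union> ?PB"
        using meetB by auto
      then have "meeting B P = crossing A B P + card ?PB"
        unfolding meeting_def crossing_def using fP by (simp add: card_Un_disjoint disjoint_iff)
      then have PB: "card ?PB = meeting B P - crossing A B P" and le: "crossing A B P \<le> meeting B P" by auto
      have "sum ?h (insert {} P) = ?h {} + (sum ?h ?PA + sum ?h ?PB)"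
      proof -
        have "sum ?h P = sum ?h (?PA \<union> ?PB)" by (rule sum.cong) auto
        also have "\<dots> = sum ?h ?PA + sum ?h ?PB" using fP by (intro sum.union_disjoint) auto
        finally show ?thesis using fP ne by simp
      qed
      also have "?h {} = of_bool (i > 0) * ?N (i - 1) j t P"
        by (auto simp: A B AB)
      also have "sum ?h ?PA = (\<Sum>C\<in>?PA. ?N i j t P)"
        by (rule sum.cong) (auto simp: A B AB)
      also have "\<dots> = i * ?N i j t P" by (simp add: meeting_def)
      also have "sum ?h ?PB = (\<Sum>C\<in>?PB. of_bool (i > 0 \<and> t > 0) * ?N (i - 1) j (t - 1) P)"
        using meetB by (intro sum.cong) (auto simp: A B AB)
      also have "\<dots> = of_bool (i > 0 \<and> t > 0) * (Suc j - t) * ?N (i - 1) j (t - 1) P"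
        using PB le by auto
      finally show "sum ?h (insert {} P) = of_bool (i > 0) * ?N (i - 1) j t P + i * ?N i j t P +
        of_bool (i > 0 \<and> t > 0) * (Suc j - t) * ?N (i - 1) j (t - 1) P"
        by simp
    qed
    also have "\<dots> = of_bool (i > 0) * (\<Sum>P \<in> set_partitions ?U. ?N (i - 1) j t P) +
        i * (\<Sum>P \<in> set_partitions ?U. ?N i j t P) +
        of_bool (i > 0 \<and> t > 0) * (Suc j - t) * (\<Sum>P \<in> set_partitions ?U. ?N (i - 1) j (t - 1) P)"
      by (simp only: sum.distrib sum_distrib_left)
    also have "\<dots> = Stirling (card (insert x A)) i * Stirling (card B) j *
        ((i choose t) * (j choose t) * fact t)"
    proof (cases i)
      case 0
      then show ?thesis using insert by simp
    next
      case (Suc i')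
      show ?thesis
      proof (cases t)
        case 0
        then show ?thesis using insert Suc by (simp add: insert.IH[OF dis] algebra_simps)
      next
        case (Suc t')
        \<comment> \<open>The factor \<open>j - t'\<close> is absorbed by moving from
          \<open>t'\<close> to \<open>Suc t'\<close> in the second binomial and the factorial. What
          remains is Pascal's rule in \<open>i\<close> followed by the Stirling recurrence.\<close>
        have "(j - t') * (a * ((i' choose t') * (j choose t') * fact t')) =
            a * (i' choose t') * fact t' * ((j - t') * (j choose t'))" for a :: nat
          by (simp only: ac_simps)
        also have "(j - t') * (j choose t') = Suc t' * (j choose Suc t')"
          by (simp only: binomial_absorption binomial_absorb_comp)
        also have "a * (i' choose t') * fact t' * (Suc t' * (j choose Suc t')) =
            a * ((i' choose t') * (j choose Suc t') * fact (Suc t'))" for a :: nat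
          by (simp only: fact_Suc of_nat_id ac_simps)
        finally have last: "(j - t') * (a * ((i' choose t') * (j choose t') * fact t')) =
            a * ((i' choose t') * (j choose Suc t') * fact (Suc t'))" for a :: nat .
        show ?thesis using insert.hyps Suc \<open>i = Suc i'\<close>
          by (simp add: insert.IH[OF dis] last del: fact_Suc) (simp add: add_mult_distrib add_mult_distrib2 mult_ac)
      qed
    qed
    finally show ?case .
  qed
  then show ?thesis using finite_set_partitions[of "A \<union> B"] assms(1,2)
    by (simp add: of_bool_def sum.If_cases Int_def)
qed

text \<open>The number of set partitions of a \<open>k\<close>-set in which \<open>t\<close> of the blocks are marked.\<close>

definition marked_partitions :: "nat \<Rightarrow> nat \<Rightarrow> nat" where
  "marked_partitions k t = (\<Sum>j\<le>k. Stirling k j * (j choose t))"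

lemma marked_partitions_0: "marked_partitions 0 t = of_bool (t = 0)"
  by (cases t) (simp_all add: marked_partitions_def)

text \<open>The new element is a marked or an unmarked singleton, joins one of the \<open>t\<close>
  marked blocks, or joins an unmarked block. For the last, marking \<open>t\<close> blocks and
  picking an unmarked one is the same as marking \<open>t + 1\<close> blocks and singling out one of
  them. The computation mirrors this: \<open>pascal\<close> treats the singleton and
  \<open>absorb\<close> splits the \<open>j\<close> blocks to be joined.\<close>

lemma marked_partitions_Suc:
  "marked_partitions (Suc k) t =
    of_bool (t > 0) * marked_partitions k (t - 1) + Suc t * marked_partitions k t +
    Suc t * marked_partitions k (Suc t)"
proof -
  have absorb: "j * (j choose t) = t * (j choose t) + Suc t * (j choose Suc t)" for j
  proof (cases "t \<le> j")
    case True
    have "Suc t * (j choose Suc t) = (j - t) * (j choose t)"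
      by (simp only: binomial_absorption binomial_absorb_comp)
    then show ?thesis using True by (metis add_mult_distrib le_add_diff_inverse)
  qed (simp add: binomial_eq_0)
  have pascal: "Suc j choose t = (j choose t) + of_bool (t > 0) * (j choose (t - 1))" for j
    by (cases t) auto
  have "marked_partitions (Suc k) t = (\<Sum>j\<le>k. Stirling (Suc k) (Suc j) * (Suc j choose t))"
    unfolding marked_partitions_def by (subst sum.atMost_Suc_shift) simp
  also have "\<dots> = (\<Sum>j\<le>k. Suc j * Stirling k (Suc j) * (Suc j choose t)) +
      (\<Sum>j\<le>k. Stirling k j * (Suc j choose t))"
    by (simp add: add_mult_distrib sum.distrib del: mult_Suc binomial_Suc_Suc)
  \<comment> \<open>The shift adds a term at \<open>j = 0\<close> that vanishes by its factor
    \<open>j\<close>; the top term is dropped next because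
    \<open>Stirling k (Suc k) = 0\<close>.\<close>
  also have "(\<Sum>j\<le>k. Suc j * Stirling k (Suc j) * (Suc j choose t)) =
      (\<Sum>j\<le>Suc k. j * Stirling k j * (j choose t))"
    unfolding sum.atMost_Suc_shift[of "\<lambda>j. j * Stirling k j * (j choose t)"] by simp
  also have "\<dots> = (\<Sum>j\<le>k. Stirling k j * (j * (j choose t)))"
    by (simp add: ac_simps)
  also have "\<dots> + (\<Sum>j\<le>k. Stirling k j * (Suc j choose t)) =
    (\<Sum>j\<le>k. of_bool (t > 0) * (Stirling k j * (j choose (t - 1))) +
      Suc t * (Stirling k j * (j choose t)) + Suc t * (Stirling k j * (j choose Suc t)))"
    unfolding sum.distrib[symmetric] absorb pascal
    by (intro sum.cong refl) (simp only: algebra_simps mult_Suc)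
  also have "\<dots> = of_bool (t > 0) * marked_partitions k (t - 1) + Suc t * marked_partitions k t +
      Suc t * marked_partitions k (Suc t)"
    unfolding marked_partitions_def by (simp only: sum.distrib sum_distrib_left)
  finally show ?thesis .
qed

section \<open>Diagrams with a given propagating number\<close>

lemma card_Collect_by_values:
  fixes f g :: "'a \<Rightarrow> nat"
  assumes "finite S" "\<And>x. x \<in> S \<Longrightarrow> f x \<le> m \<and> g x \<le> n"
  shows "card {x \<in> S. R x} = (\<Sum>i\<le>m. \<Sum>j\<le>n. card {x \<in> S. f x = i \<and> g x = j \<and> R x})"
proof -
  let ?S = "\<lambda>i j. {x \<in> S. f x = i \<and> g x = j \<and> R x}"
  have fin: "finite (?S i j)" for i j using assms(1) by simp
  have "{x \<in> S. R x} = (\<Union>i\<in>{..m}. \<Union>j\<in>{..n}. ?S i j)" using assms(2) by auto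
  also have "card \<dots> = (\<Sum>i\<le>m. card (\<Union>j\<in>{..n}. ?S i j))"
    using fin by (intro card_UN_disjoint) auto
  also have "\<dots> = (\<Sum>i\<le>m. \<Sum>j\<le>n. card (?S i j))"
    using fin by (intro sum.cong refl card_UN_disjoint) auto
  finally show ?thesis .
qed

text \<open>When the gluing count is summed over the numbers of blocks met by the two rows, the
  double sum factors into two equal sums, one for each row.\<close>

lemma card_partition_diagrams_pn:
  "card {d \<in> partition_diagrams k. pn k d = t} = fact t * (marked_partitions k t)\<^sup>2"
proof -
  let ?A = "Inl ` {1..k} :: (nat + nat) set" and ?B = "Inr ` {1..k} :: (nat + nat) set"
  have AB: "finite ?A" "finite ?B" "?A \<inter> ?B = {}" "card ?A = k" "card ?B = k"
    by (auto simp: card_image)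
  have PD: "partition_diagrams k = set_partitions (?A \<union> ?B)"
    by (simp only: partition_diagrams_def set_partitions_def Plus_def)
  have pn: "pn k P = crossing ?A ?B P" for P
    by (simp only: pn_def crossing_def)
  let ?S = "\<lambda>i j. {P \<in> set_partitions (?A \<union> ?B).
    meeting ?A P = i \<and> meeting ?B P = j \<and> crossing ?A ?B P = t}"
  \<comment> \<open>This bounds the summation ranges. Picking a point of \<open>X\<close> from each
    block that meets it is injective, since blocks are disjoint.\<close>
  have meeting_le: "meeting X P \<le> card X" if "partition_on V P" "finite V" "X \<subseteq> V" for X P and V :: "'a set"
  proof -
    have fin: "finite X" using that finite_subset by blast
    define f where "f D = (SOME a. a \<in> D \<inter> X)" for D
    have f: "f D \<in> D \<inter> X" if "D \<inter> X \<noteq> {}" for D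
      using that unfolding f_def by (subst some_in_eq)
    have "inj_on f {D \<in> P. D \<inter> X \<noteq> {}}"
    proof (rule inj_onI)
      fix D D' assume D: "D \<in> {D \<in> P. D \<inter> X \<noteq> {}}" "D' \<in> {D \<in> P. D \<inter> X \<noteq> {}}" "f D = f D'"
      then have "f D \<in> D \<inter> D'" using f[of D] f[of D'] by auto
      then show "D = D'" using D disjointD[OF partition_onD2[OF that(1)], of D D'] by blast
    qed
    then show ?thesis
      unfolding meeting_def using f fin by (intro card_inj_on_le[of f]) auto
  qed
  have "meeting ?A P \<le> k \<and> meeting ?B P \<le> k" if "P \<in> set_partitions (?A \<union> ?B)" for P
    using that meeting_le[of "?A \<union> ?B" P ?A] meeting_le[of "?A \<union> ?B" P ?B] AB
    unfolding set_partitions_def by fastforce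
  then have "card {d \<in> partition_diagrams k. pn k d = t} = (\<Sum>i\<le>k. \<Sum>j\<le>k. card (?S i j))"
    unfolding PD pn using finite_set_partitions[OF finite_UnI[OF AB(1,2)]]
    by (intro card_Collect_by_values) blast+
  also have "\<dots> = (\<Sum>i\<le>k. \<Sum>j\<le>k. fact t * ((Stirling k i * (i choose t)) * (Stirling k j * (j choose t))))"
    unfolding card_partitions_by_crossing[OF AB(1-3)] AB(4,5) by (simp only: ac_simps)
  also have "\<dots> = fact t * (marked_partitions k t)\<^sup>2"
    unfolding marked_partitions_def power2_eq_square sum_product by (simp only: sum_distrib_left)
  finally show ?thesis .
qed

section \<open>Standard tableaux and Young's lattice\<close>

text \<open>Young diagrams are finite down-closed sets of boxes, so that adding or removing a box is
  a plain set operation.\<close>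

definition diagram :: "(nat \<times> nat) set \<Rightarrow> bool" where
  "diagram Y \<longleftrightarrow> finite Y \<and> (\<forall>i j i' j'. (i, j) \<in> Y \<longrightarrow> i' \<le> i \<longrightarrow> j' \<le> j \<longrightarrow> (i', j') \<in> Y)"

definition addable :: "(nat \<times> nat) set \<Rightarrow> (nat \<times> nat) set" where
  "addable Y = {b. b \<notin> Y \<and> diagram (insert b Y)}"

definition removable :: "(nat \<times> nat) set \<Rightarrow> (nat \<times> nat) set" where
  "removable Y = {b \<in> Y. diagram (Y - {b})}"

lemma diagram_Un: "diagram X \<Longrightarrow> diagram Y \<Longrightarrow> diagram (X \<union> Y)"
  unfolding diagram_def by blast

lemma diagram_Int: "diagram X \<Longrightarrow> diagram Y \<Longrightarrow> diagram (X \<inter> Y)"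
  unfolding diagram_def by blast

lemma finite_removable: "diagram Y \<Longrightarrow> finite (removable Y)"
  by (auto simp: diagram_def removable_def)

definition row :: "(nat \<times> nat) set \<Rightarrow> nat \<Rightarrow> nat" where
  "row Y i = card {j. (i, j) \<in> Y}"

lemma finite_down_closed_nat:
  fixes S :: "nat set"
  assumes fin: "finite S" and down: "\<And>i j. j \<in> S \<Longrightarrow> i \<le> j \<Longrightarrow> i \<in> S"
  shows "S = {..<card S}"
proof (cases "S = {}")
  case False
  have "S = {..Max S}"
    using down[OF Max_in[OF fin False]] Max_ge[OF fin] by blast
  then obtain m where "S = {..m}" ..
  then show ?thesis by (simp add: lessThan_Suc_atMost)
qed simp

lemma diagram_mem_iff_row:
  assumes "diagram Y"
  shows "(i, j) \<in> Y \<longleftrightarrow> j < row Y i"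
proof -
  have "{j. (i, j) \<in> Y} \<subseteq> snd ` Y" by force
  then have "finite {j. (i, j) \<in> Y}" using assms finite_subset by (auto simp: diagram_def)
  then have "{j. (i, j) \<in> Y} = {..<row Y i}"
    unfolding row_def by (rule finite_down_closed_nat) (use assms in \<open>auto simp: diagram_def\<close>)
  then show ?thesis by auto
qed

lemma row_antimono:
  assumes "diagram Y" "i \<le> i'"
  shows "row Y i' \<le> row Y i"
proof (rule ccontr)
  assume "\<not> ?thesis"
  then have "(i', row Y i) \<in> Y" by (simp add: diagram_mem_iff_row[OF assms(1)])
  then have "(i, row Y i) \<in> Y" using assms by (auto simp: diagram_def)
  then show False by (simp add: diagram_mem_iff_row[OF assms(1)])
qed

text \<open>Down-closure forces a new box to the end of its row and, except in row \<open>0\<close>,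
  directly below a box already present.\<close>

lemma addable_eq:
  assumes "diagram Y"
  shows "addable Y = (\<lambda>i. (i, row Y i)) ` {i. i = 0 \<or> row Y (i - 1) > row Y i}"
proof (rule set_eqI)
  note mem = diagram_mem_iff_row[OF assms]
  fix b :: "nat \<times> nat"
  obtain i j where b: "b = (i, j)" by force
  have "b \<in> addable Y \<longleftrightarrow> j = row Y i \<and> (i = 0 \<or> row Y (i - 1) > row Y i)"
  proof
    assume "b \<in> addable Y"
    then have nin: "(i, j) \<notin> Y" and d: "diagram (insert (i, j) Y)" by (auto simp: addable_def b)
    have le: "row Y i \<le> j" using nin by (simp add: mem)
    moreover have "j \<le> row Y i"
    proof (rule ccontr)
      assume "\<not> ?thesis"
      moreover have "(i, row Y i) \<in> insert (i, j) Y" using d le by (auto simp: diagram_def)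
      ultimately show False by (simp add: mem)
    qed
    ultimately have j: "j = row Y i" by simp
    have "row Y (i - 1) > row Y i" if "i \<noteq> 0"
    proof -
      have "(i - 1, j) \<in> insert (i, j) Y"
        using d by (meson diagram_def diff_le_self insertI1 order_refl)
      then show ?thesis using that j by (cases i) (auto simp: mem)
    qed
    with j show "j = row Y i \<and> (i = 0 \<or> row Y (i - 1) > row Y i)" by blast
  next
    assume r: "j = row Y i \<and> (i = 0 \<or> row Y (i - 1) > row Y i)"
    have "(i', j') \<in> insert (i, j) Y" if "i' \<le> i" "j' \<le> j" for i' j'
    proof (cases "i' = i")
      case True
      then show ?thesis using r that by (auto simp: mem)
    next
      case False
      then have "row Y (i - 1) \<le> row Y i'" using that by (intro row_antimono assms) auto
      then show ?thesis using False r that by (auto simp: mem)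
    qed
    then have "diagram (insert (i, j) Y)" using assms unfolding diagram_def by blast
    then show "b \<in> addable Y" using r by (simp add: addable_def b mem)
  qed
  then show "b \<in> addable Y \<longleftrightarrow> b \<in> (\<lambda>i. (i, row Y i)) ` {i. i = 0 \<or> row Y (i - 1) > row Y i}"
    by (auto simp: b)
qed

text \<open>A removable box has no box to its right or below it, so it ends a row longer than the
  next one. Such a row is nonempty, hence \<open>row Y i - 1\<close> is a true predecessor.\<close>

lemma removable_eq:
  assumes "diagram Y"
  shows "removable Y = (\<lambda>i. (i, row Y i - 1)) ` {i. row Y i > row Y (Suc i)}"
proof (rule set_eqI)
  note mem = diagram_mem_iff_row[OF assms]
  fix b :: "nat \<times> nat"
  obtain i j where b: "b = (i, j)" by force
  have "b \<in> removable Y \<longleftrightarrow> Suc j = row Y i \<and> row Y i > row Y (Suc i)"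
  proof
    assume "b \<in> removable Y"
    then have i: "(i, j) \<in> Y" and d: "diagram (Y - {(i, j)})" by (auto simp: removable_def b)
    have "(i', j') \<notin> Y" if "(i', j') \<noteq> (i, j)" "i \<le> i'" "j \<le> j'" for i' j'
      using d that unfolding diagram_def by blast
    from this[of i "Suc j"] this[of "Suc i" j] have "(i, Suc j) \<notin> Y" "(Suc i, j) \<notin> Y"
      by auto
    with i show "Suc j = row Y i \<and> row Y i > row Y (Suc i)" by (simp add: mem)
  next
    assume r: "Suc j = row Y i \<and> row Y i > row Y (Suc i)"
    have "(i', j') = (i, j)" if "(i', j') \<in> Y" "i \<le> i'" "j \<le> j'" for i' j'
    proof -
      have "i' = i"
      proof (rule ccontr)
        assume "i' \<noteq> i"
        then have "row Y i' \<le> row Y (Suc i)" using that by (intro row_antimono assms) auto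
        then show False using that r by (simp add: mem)
      qed
      then show ?thesis using that r by (simp add: mem)
    qed
    then have "diagram (Y - {(i, j)})" using assms unfolding diagram_def by blast
    then show "b \<in> removable Y" using r by (simp add: removable_def b mem)
  qed
  then show "b \<in> removable Y \<longleftrightarrow> b \<in> (\<lambda>i. (i, row Y i - 1)) ` {i. row Y i > row Y (Suc i)}"
    by (auto simp: b)
qed

text \<open>A box can be removed from row \<open>i\<close> iff one can be added to row \<open>i + 1\<close>; row \<open>0\<close> is always
  addable.\<close>

lemma card_addable:
  assumes "diagram Y"
  shows "finite (addable Y) \<and> card (addable Y) = Suc (card (removable Y))"
proof -
  let ?I = "{i. row Y i > row Y (Suc i)}"
  have R: "card (removable Y) = card ?I"
    unfolding removable_eq[OF assms] by (intro card_image inj_onI) auto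
  have "finite ?I"
    using finite_removable[OF assms] unfolding removable_eq[OF assms]
    by (rule finite_imageD) (auto intro: inj_onI)
  moreover have I: "{i. i = 0 \<or> row Y (i - 1) > row Y i} = insert 0 (Suc ` ?I)"
  proof -
    have "i = 0 \<or> row Y (i - 1) > row Y i \<longleftrightarrow> i \<in> insert 0 (Suc ` ?I)" for i
      by (cases i) auto
    then show ?thesis by blast
  qed
  moreover have "card (addable Y) = card {i. i = 0 \<or> row Y (i - 1) > row Y i}"
    unfolding addable_eq[OF assms] by (intro card_image inj_onI) auto
  ultimately show ?thesis using R by (simp add: addable_eq[OF assms] card_image)
qed

section \<open>Commutation of adding and removing boxes\<close>

lemma diagram_insert: "b \<in> addable Y \<Longrightarrow> diagram (insert b Y)"
  by (simp add: addable_def)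

lemma diagram_remove: "b \<in> removable Y \<Longrightarrow> diagram (Y - {b})"
  by (simp add: removable_def)

text \<open>Diagrams are closed under intersection and union. In the square with corners
  \<open>Y\<close>, \<open>insert b Y\<close>, \<open>Y - {c}\<close> and
  \<open>insert b Y - {c}\<close>, the intersection or union of two opposite corners therefore
  supplies the missing one.\<close>

lemma addable_removable_swap:
  assumes "diagram Y" "b \<noteq> c"
  shows "b \<in> addable Y \<and> c \<in> removable (insert b Y) \<longleftrightarrow> c \<in> removable Y \<and> b \<in> addable (Y - {c})"
    (is "?L \<longleftrightarrow> ?R")
proof
  assume L: ?L
  have "Y \<inter> (insert b Y - {c}) = Y - {c}" using L by (auto simp: addable_def)
  then have "diagram (Y - {c})" using L assms(1) diagram_Int by (metis diagram_remove)
  moreover have "insert b (Y - {c}) = insert b Y - {c}" using assms by auto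
  ultimately show ?R using L assms by (auto simp: addable_def removable_def)
next
  assume R: ?R
  have "Y \<union> insert b (Y - {c}) = insert b Y" by auto
  then have "diagram (insert b Y)" using R assms(1) diagram_Un by (metis diagram_insert)
  moreover have "insert b (Y - {c}) = insert b Y - {c}" using assms by auto
  ultimately show ?L using R assms by (auto simp: addable_def removable_def)
qed

text \<open>The relation \<open>DU = UD + 1\<close> of the down and up operators on Young's lattice.\<close>

lemma sum_down_up:
  fixes G :: "(nat \<times> nat) set \<Rightarrow> nat"
  assumes "diagram Y"
  shows "(\<Sum>b \<in> addable Y. \<Sum>c \<in> removable (insert b Y). G (insert b Y - {c})) =
    (\<Sum>c \<in> removable Y. \<Sum>b \<in> addable (Y - {c}). G (insert b (Y - {c}))) + G Y"
proof -
  have A: "finite (addable Y)" "card (addable Y) = Suc (card (removable Y))"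
    using card_addable[OF assms] by auto
  \<comment> \<open>The diagonal term \<open>c = b\<close> leads back to \<open>Y\<close>; it occurs
    once for each addable box.\<close>
  have "(\<Sum>c \<in> removable (insert b Y). G (insert b Y - {c})) =
      G Y + (\<Sum>c \<in> removable (insert b Y) - {b}. G (insert b Y - {c}))"
    if "b \<in> addable Y" for b
  proof -
    have "b \<in> removable (insert b Y)" "insert b Y - {b} = Y"
      using that assms by (auto simp: addable_def removable_def)
    then show ?thesis using finite_removable[OF diagram_insert[OF that]]
      by (simp add: sum.remove)
  qed
  then have 1: "(\<Sum>b \<in> addable Y. \<Sum>c \<in> removable (insert b Y). G (insert b Y - {c})) =
      card (addable Y) * G Y +
      (\<Sum>b \<in> addable Y. \<Sum>c \<in> removable (insert b Y) - {b}. G (insert b Y - {c}))"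
    by (simp add: sum.distrib)
  \<comment> \<open>Here the diagonal term occurs once for each removable box, so the two diagonal
    totals differ by exactly one \<open>G Y\<close>.\<close>
  have "(\<Sum>b \<in> addable (Y - {c}). G (insert b (Y - {c}))) =
      G Y + (\<Sum>b \<in> addable (Y - {c}) - {c}. G (insert b (Y - {c})))"
    if "c \<in> removable Y" for c
  proof -
    have "c \<in> addable (Y - {c})" "insert c (Y - {c}) = Y"
      using that assms by (auto simp: addable_def removable_def insert_absorb)
    then show ?thesis using card_addable[OF diagram_remove[OF that]]
      by (simp add: sum.remove)
  qed
  then have 2: "(\<Sum>c \<in> removable Y. \<Sum>b \<in> addable (Y - {c}). G (insert b (Y - {c}))) =
      card (removable Y) * G Y +
      (\<Sum>c \<in> removable Y. \<Sum>b \<in> addable (Y - {c}) - {c}. G (insert b (Y - {c})))"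
    by (simp add: sum.distrib)
  \<comment> \<open>Off the diagonal the two moves commute, so both sums run over the same
    pairs.\<close>
  have "(\<Sum>(b, c) \<in> Sigma (addable Y) (\<lambda>b. removable (insert b Y) - {b}). G (insert b Y - {c})) =
      (\<Sum>(c, b) \<in> Sigma (removable Y) (\<lambda>c. addable (Y - {c}) - {c}). G (insert b (Y - {c})))"
  proof (rule sum.reindex_bij_witness[where i = "\<lambda>(c, b). (b, c)" and j = "\<lambda>(b, c). (c, b)"])
    fix p assume p: "p \<in> Sigma (addable Y) (\<lambda>b. removable (insert b Y) - {b})"
    then obtain b c where bc: "p = (b, c)" "b \<noteq> c" by blast
    then show "(case p of (b, c) \<Rightarrow> (c, b)) \<in> Sigma (removable Y) (\<lambda>c. addable (Y - {c}) - {c})"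
      using p addable_removable_swap[OF assms bc(2)] by auto
    show "(case case p of (b, c) \<Rightarrow> (c, b) of (c, b) \<Rightarrow> G (insert b (Y - {c}))) =
        (case p of (b, c) \<Rightarrow> G (insert b Y - {c}))"
      using bc by (simp add: insert_Diff_if)
  next
    fix p assume p: "p \<in> Sigma (removable Y) (\<lambda>c. addable (Y - {c}) - {c})"
    then obtain b c where bc: "p = (c, b)" "b \<noteq> c" by blast
    then show "(case p of (c, b) \<Rightarrow> (b, c)) \<in> Sigma (addable Y) (\<lambda>b. removable (insert b Y) - {b})"
      using p addable_removable_swap[OF assms bc(2)] by auto
  qed auto
  then have "(\<Sum>b \<in> addable Y. \<Sum>c \<in> removable (insert b Y) - {b}. G (insert b Y - {c})) =
      (\<Sum>c \<in> removable Y. \<Sum>b \<in> addable (Y - {c}) - {c}. G (insert b (Y - {c})))"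
    using A(1) finite_removable[OF assms] card_addable[OF diagram_remove]
      finite_removable[OF diagram_insert]
    by (simp add: sum.Sigma)
  then show ?thesis using 1 2 A(2) by simp
qed

text \<open>\<open>num_SYT n Y\<close> counts the standard Young tableaux of shape \<open>Y\<close> if \<open>Y\<close> has \<open>n\<close> boxes,
  and is \<open>0\<close> otherwise.\<close>

primrec num_SYT :: "nat \<Rightarrow> (nat \<times> nat) set \<Rightarrow> nat" where
  "num_SYT 0 Y = of_bool (Y = {})"
| "num_SYT (Suc n) Y = (\<Sum>c \<in> removable Y. num_SYT n (Y - {c}))"

text \<open>As \<open>num_SYT n\<close> is the coefficient function of \<open>U^n\<close> applied to
  the empty diagram, this is the rule that \<open>D\<close> acts on powers of \<open>U\<close> like
  a derivative. Each commutation of \<open>D\<close> past a \<open>U\<close> contributes one further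
  copy.\<close>

lemma sum_num_SYT_addable:
  "diagram Y \<Longrightarrow> (\<Sum>b \<in> addable Y. num_SYT (Suc n) (insert b Y)) = Suc n * num_SYT n Y"
proof (induction n arbitrary: Y)
  case 0
  \<comment> \<open>In the double sum over \<open>Y - {c}\<close> every argument of
    \<open>num_SYT 0\<close> contains a box, so only the extra term \<open>num_SYT 0 Y\<close>
    survives.\<close>
  then show ?case using sum_down_up[of Y "num_SYT 0"] by simp
next
  case (Suc n)
  have "(\<Sum>b \<in> addable Y. num_SYT (Suc (Suc n)) (insert b Y)) =
      (\<Sum>b \<in> addable Y. \<Sum>c \<in> removable (insert b Y). num_SYT (Suc n) (insert b Y - {c}))"
    by simp
  also have "\<dots> = (\<Sum>c \<in> removable Y. \<Sum>b \<in> addable (Y - {c}). num_SYT (Suc n) (insert b (Y - {c})))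
      + num_SYT (Suc n) Y"
    by (rule sum_down_up[OF Suc.prems])
  also have "\<dots> = (\<Sum>c \<in> removable Y. Suc n * num_SYT n (Y - {c})) + num_SYT (Suc n) Y"
    by (simp add: Suc.IH[OF diagram_remove] del: num_SYT.simps mult_Suc cong: sum.cong)
  also have "\<dots> = Suc (Suc n) * num_SYT (Suc n) Y"
    by (simp add: sum_distrib_left sum.distrib)
  finally show ?case .
qed

section \<open>The sum of squares of the numbers of standard tableaux\<close>

definition diagrams :: "nat \<Rightarrow> (nat \<times> nat) set set" where
  "diagrams n = {Y. diagram Y \<and> card Y = n}"

text \<open>A box \<open>(i, j)\<close> forces the whole rectangle up to it, so
  \<open>Suc i * Suc j\<close> is at most \<open>n\<close> and both coordinates are below
  \<open>n\<close>.\<close>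

lemma finite_diagrams: "finite (diagrams n)"
proof -
  have "Y \<subseteq> {..<n} \<times> {..<n}" if Y: "Y \<in> diagrams n" for Y
  proof
    fix b assume b: "b \<in> Y"
    obtain i j where ij: "b = (i, j)" by force
    have "{..i} \<times> {..j} \<subseteq> Y" using Y b by (auto simp: diagrams_def diagram_def ij)
    then have "Suc i * Suc j \<le> n"
      using Y card_mono[of Y "{..i} \<times> {..j}"]
      by (simp add: diagrams_def diagram_def card_cartesian_product)
    then show "b \<in> {..<n} \<times> {..<n}" by (auto simp: ij)
  qed
  then have "diagrams n \<subseteq> Pow ({..<n} \<times> {..<n})" by blast
  then show ?thesis by (rule finite_subset) simp
qed

lemma diagrams_remove:
  assumes "Y \<in> diagrams (Suc n)" "c \<in> removable Y"
  shows "Y - {c} \<in> diagrams n" "c \<in> addable (Y - {c})" "insert c (Y - {c}) = Y"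
proof -
  show eq: "insert c (Y - {c}) = Y" using assms(2) by (auto simp: removable_def)
  show "Y - {c} \<in> diagrams n" using assms by (auto simp: removable_def diagrams_def)
  show "c \<in> addable (Y - {c})"
  proof -
    have "diagram (insert c (Y - {c}))" unfolding eq using assms(1) by (simp add: diagrams_def)
    then show ?thesis by (simp add: addable_def)
  qed
qed

lemma diagrams_insert:
  assumes "Z \<in> diagrams n" "b \<in> addable Z"
  shows "insert b Z \<in> diagrams (Suc n)" "b \<in> removable (insert b Z)" "insert b Z - {b} = Z"
proof -
  show eq: "insert b Z - {b} = Z" using assms(2) by (auto simp: addable_def)
  have "finite Z" using assms(1) by (simp add: diagrams_def diagram_def)
  then show "insert b Z \<in> diagrams (Suc n)" using assms by (auto simp: addable_def diagrams_def)
  show "b \<in> removable (insert b Z)"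
    using assms(1) unfolding removable_def by (simp add: eq diagrams_def)
qed

text \<open>\<open>U\<close> and \<open>D\<close> are adjoint: one factor is expanded by removing a
  box, and the sum over edges of Young's lattice is then regrouped by the smaller diagram. Adding a
  box there yields the factor \<open>Suc n\<close>.\<close>

lemma sum_num_SYT_squares: "(\<Sum>Y \<in> diagrams n. (num_SYT n Y)\<^sup>2) = fact n"
proof (induction n)
  case 0
  have "diagrams 0 = {{}}" by (auto simp: diagrams_def diagram_def)
  then show ?case by simp
next
  case (Suc n)
  have fin: "finite (removable Y)" if "Y \<in> diagrams m" for Y m
    using that by (simp add: diagrams_def finite_removable)
  have fin': "finite (addable Y)" if "Y \<in> diagrams m" for Y m
    using that by (simp add: diagrams_def card_addable)
  have "(\<Sum>Y \<in> diagrams (Suc n). (num_SYT (Suc n) Y)\<^sup>2) =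
      (\<Sum>Y \<in> diagrams (Suc n). \<Sum>c \<in> removable Y. num_SYT (Suc n) Y * num_SYT n (Y - {c}))"
    by (simp add: power2_eq_square sum_distrib_left)
  also have "\<dots> = (\<Sum>(Y, c) \<in> Sigma (diagrams (Suc n)) removable. num_SYT (Suc n) Y * num_SYT n (Y - {c}))"
    using fin by (simp add: finite_diagrams sum.Sigma)
  also have "\<dots> = (\<Sum>(Z, b) \<in> Sigma (diagrams n) addable. num_SYT (Suc n) (insert b Z) * num_SYT n Z)"
    by (rule sum.reindex_bij_witness[where i = "\<lambda>(Z, b). (insert b Z, b)" and j = "\<lambda>(Y, c). (Y - {c}, c)"])
      (use diagrams_remove diagrams_insert in fastforce)+
  also have "\<dots> = (\<Sum>Z \<in> diagrams n. (\<Sum>b \<in> addable Z. num_SYT (Suc n) (insert b Z)) * num_SYT n Z)"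
    using fin' by (simp add: finite_diagrams sum.Sigma sum_distrib_right del: num_SYT.simps)
  also have "\<dots> = (\<Sum>Z \<in> diagrams n. Suc n * (num_SYT n Z)\<^sup>2)"
    by (intro sum.cong refl) (simp add: sum_num_SYT_addable diagrams_def power2_eq_square mult.assoc del: num_SYT.simps mult_Suc)
  also have "\<dots> = fact (Suc n)" by (simp only: Suc.IH fact_Suc of_nat_id flip: sum_distrib_left)
  finally show ?case .
qed

section \<open>Vacillating tableaux\<close>

lemma mem_young_diagram: "(i, j) \<in> young_diagram \<nu> \<longleftrightarrow> i < length \<nu> \<and> j < \<nu> ! i"
  by (simp add: young_diagram_def)

lemma diagram_young_diagram:
  assumes "is_int_partition \<nu>"
  shows "diagram (young_diagram \<nu>)"
proof -
  have "young_diagram \<nu> = Sigma {..<length \<nu>} (\<lambda>i. {..<\<nu> ! i})"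
    by (auto simp: young_diagram_def)
  moreover have "\<nu> ! i \<le> \<nu> ! i'" if "i' \<le> i" "i < length \<nu>" for i i'
  proof (cases "i' = i")
    case False
    then show ?thesis using that assms by (simp add: is_int_partition_def sorted_wrt_iff_nth_less)
  qed simp
  ultimately show ?thesis
    unfolding diagram_def by (auto simp: mem_young_diagram) (meson le_less_trans order.strict_trans2)+
qed

lemma card_young_diagram: "card (young_diagram \<nu>) = sum_list \<nu>"
proof -
  have "young_diagram \<nu> = Sigma {..<length \<nu>} (\<lambda>i. {..<\<nu> ! i})"
    by (auto simp: young_diagram_def)
  then show ?thesis by (simp add: sum_list_sum_nth atLeast0LessThan)
qed

text \<open>Since parts are positive, column \<open>0\<close> determines the length of the list, and
  the rows then determine its entries.\<close>

lemma inj_on_young_diagram: "inj_on young_diagram {\<nu>. is_int_partition \<nu>}"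
proof (rule inj_onI)
  fix \<nu> \<mu> assume "\<nu> \<in> {\<nu>. is_int_partition \<nu>}" "\<mu> \<in> {\<nu>. is_int_partition \<nu>}"
    and eq: "young_diagram \<nu> = young_diagram \<mu>"
  then have pos: "i < length \<nu> \<Longrightarrow> 0 < \<nu> ! i" "i < length \<mu> \<Longrightarrow> 0 < \<mu> ! i" for i
    by (auto simp: is_int_partition_def)
  have mem: "i < length \<nu> \<and> j < \<nu> ! i \<longleftrightarrow> i < length \<mu> \<and> j < \<mu> ! i" for i j
    using eq by (simp flip: mem_young_diagram)
  have "i < length \<nu> \<longleftrightarrow> i < length \<mu>" for i using mem[of i 0] pos[of i] by auto
  then have len: "length \<nu> = length \<mu>" by (metis linorder_neqE_nat less_irrefl)
  show "\<nu> = \<mu>"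
  proof (rule nth_equalityI[OF len])
    fix i assume "i < length \<nu>"
    then have "j < \<nu> ! i \<longleftrightarrow> j < \<mu> ! i" for j using mem[of i j] len by auto
    then show "\<nu> ! i = \<mu> ! i" by (metis linorder_neqE_nat less_irrefl)
  qed
qed

text \<open>Column \<open>0\<close> is an initial segment and gives the number \<open>n\<close> of
  nonempty rows; the lengths of these rows are the parts.\<close>

lemma diagram_eq_young_diagram:
  assumes "diagram Y"
  shows "\<exists>\<nu>. is_int_partition \<nu> \<and> young_diagram \<nu> = Y"
proof -
  let ?S = "{i. (i, 0) \<in> Y}"
  have "?S \<subseteq> fst ` Y" by force
  then have "finite ?S" using assms finite_subset by (auto simp: diagram_def)
  then have "?S = {..<card ?S}"
    by (rule finite_down_closed_nat) (use assms in \<open>auto simp: diagram_def\<close>)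
  then obtain n where "?S = {..<n}" by blast
  then have S: "(i, 0) \<in> Y \<longleftrightarrow> i < n" for i by auto
  note mem = diagram_mem_iff_row[OF assms]
  let ?\<nu> = "map (row Y) [0..<n]"
  have "is_int_partition ?\<nu>"
    using row_antimono[OF assms] S by (auto simp: is_int_partition_def sorted_wrt_iff_nth_less mem)
  moreover have "(i, j) \<in> young_diagram ?\<nu> \<longleftrightarrow> (i, j) \<in> Y" for i j
    using S[of i] by (auto simp: mem_young_diagram mem)
  then have "young_diagram ?\<nu> = Y" by auto
  ultimately show ?thesis by blast
qed

lemma sum_young_diagram:
  assumes "\<And>Y. Y \<in> \<Y> \<Longrightarrow> diagram Y"
  shows "(\<Sum>\<nu> | is_int_partition \<nu> \<and> young_diagram \<nu> \<in> \<Y>. g (young_diagram \<nu>)) = sum g \<Y>"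
proof -
  have "bij_betw young_diagram {\<nu>. is_int_partition \<nu> \<and> young_diagram \<nu> \<in> \<Y>} \<Y>"
    unfolding bij_betw_def
  proof
    show "inj_on young_diagram {\<nu>. is_int_partition \<nu> \<and> young_diagram \<nu> \<in> \<Y>}"
      by (rule inj_on_subset[OF inj_on_young_diagram]) auto
    show "young_diagram ` {\<nu>. is_int_partition \<nu> \<and> young_diagram \<nu> \<in> \<Y>} = \<Y>"
    proof (intro equalityI subsetI)
      fix Y assume "Y \<in> \<Y>"
      then show "Y \<in> young_diagram ` {\<nu>. is_int_partition \<nu> \<and> young_diagram \<nu> \<in> \<Y>}"
        using diagram_eq_young_diagram[OF assms] by blast
    qed auto
  qed
  then show ?thesis by (rule sum.reindex_bij_betw)
qed

section \<open>Half-steps and the recursion for vacillating tableaux\<close>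

definition upper :: "nat list \<Rightarrow> nat list set" where
  "upper \<mu> = {\<rho>. is_int_partition \<rho> \<and> (\<mu> = \<rho> \<or> removes_box \<rho> \<mu>)}"

text \<open>Both sets look backwards along a tableau: \<open>upper\<close> collects the predecessors
  in a removing half-step, \<open>lower\<close> those in an adding half-step.\<close>

definition lower :: "nat list \<Rightarrow> nat list set" where
  "lower \<nu> = {\<mu>. is_int_partition \<mu> \<and> (\<nu> = \<mu> \<or> adds_box \<mu> \<nu>)}"

lemma upper_eq:
  assumes "is_int_partition \<mu>"
  shows "upper \<mu> = {\<rho>. is_int_partition \<rho> \<and> young_diagram \<rho> \<in>
    insert (young_diagram \<mu>) ((\<lambda>b. insert b (young_diagram \<mu>)) ` addable (young_diagram \<mu>))}"
proof -
  have "removes_box \<rho> \<mu> \<longleftrightarrow>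
      young_diagram \<rho> \<in> (\<lambda>b. insert b (young_diagram \<mu>)) ` addable (young_diagram \<mu>)"
    if "is_int_partition \<rho>" for \<rho>
    using diagram_young_diagram[OF that]
    by (auto simp: removes_box_def addable_def insert_absorb)
  moreover have "\<mu> = \<rho> \<longleftrightarrow> young_diagram \<rho> = young_diagram \<mu>" if "is_int_partition \<rho>" for \<rho>
    using that assms inj_on_young_diagram by (auto simp: inj_on_def)
  ultimately show ?thesis unfolding upper_def by blast
qed

lemma lower_eq:
  assumes "is_int_partition \<nu>"
  shows "lower \<nu> = {\<mu>. is_int_partition \<mu> \<and> young_diagram \<mu> \<in>
    insert (young_diagram \<nu>) ((\<lambda>c. young_diagram \<nu> - {c}) ` removable (young_diagram \<nu>))}"
proof -
  have "adds_box \<mu> \<nu> \<longleftrightarrow>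
      young_diagram \<mu> \<in> (\<lambda>c. young_diagram \<nu> - {c}) ` removable (young_diagram \<nu>)"
    if "is_int_partition \<mu>" for \<mu>
    using diagram_young_diagram[OF that]
    by (auto simp: adds_box_def removable_def insert_absorb)
  moreover have "\<nu> = \<mu> \<longleftrightarrow> young_diagram \<mu> = young_diagram \<nu>" if "is_int_partition \<mu>" for \<mu>
    using that assms inj_on_young_diagram by (auto simp: inj_on_def)
  ultimately show ?thesis unfolding lower_def by blast
qed

text \<open>On coefficient functions this is the operator \<open>1 + D\<close>: the value at
  \<open>Y\<close> collects those at \<open>Y\<close> and at all diagrams one box larger.\<close>

lemma sum_upper:
  fixes g :: "(nat \<times> nat) set \<Rightarrow> nat"
  assumes "is_int_partition \<mu>"
  defines "Y \<equiv> young_diagram \<mu>"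
  shows "(\<Sum>\<rho> \<in> upper \<mu>. g (young_diagram \<rho>)) = g Y + (\<Sum>b \<in> addable Y. g (insert b Y))"
proof -
  have Y: "diagram Y" unfolding Y_def by (rule diagram_young_diagram[OF assms(1)])
  let ?I = "(\<lambda>b. insert b Y) ` addable Y"
  have "(\<Sum>\<rho> \<in> upper \<mu>. g (young_diagram \<rho>)) = sum g (insert Y ?I)"
    unfolding upper_eq[OF assms(1)] Y_def[symmetric]
    using Y by (intro sum_young_diagram) (auto simp: addable_def)
  also have "\<dots> = g Y + sum g ?I"
    using card_addable[OF Y] by (intro sum.insert) (auto simp: addable_def)
  also have "sum g ?I = (\<Sum>b \<in> addable Y. g (insert b Y))"
    by (subst sum.reindex) (auto intro!: inj_onI simp: addable_def)
  finally show ?thesis .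
qed

text \<open>The counterpart for \<open>1 + U\<close>, collecting values at \<open>Y\<close> and at
  all diagrams one box smaller.\<close>

lemma sum_lower:
  fixes g :: "(nat \<times> nat) set \<Rightarrow> nat"
  assumes "is_int_partition \<nu>"
  defines "Y \<equiv> young_diagram \<nu>"
  shows "(\<Sum>\<mu> \<in> lower \<nu>. g (young_diagram \<mu>)) = g Y + (\<Sum>c \<in> removable Y. g (Y - {c}))"
proof -
  have Y: "diagram Y" unfolding Y_def by (rule diagram_young_diagram[OF assms(1)])
  let ?I = "(\<lambda>c. Y - {c}) ` removable Y"
  have "(\<Sum>\<mu> \<in> lower \<nu>. g (young_diagram \<mu>)) = sum g (insert Y ?I)"
    unfolding lower_eq[OF assms(1)] Y_def[symmetric]
    using Y by (intro sum_young_diagram) (auto simp: removable_def)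
  also have "\<dots> = g Y + sum g ?I"
    using finite_removable[OF Y] by (intro sum.insert) (auto simp: removable_def)
  also have "sum g ?I = (\<Sum>c \<in> removable Y. g (Y - {c}))"
    by (subst sum.reindex) (auto intro!: inj_onI simp: removable_def)
  finally show ?thesis .
qed

lemma finite_partitions_with_diagram:
  assumes "finite \<Y>"
  shows "finite {\<nu>. is_int_partition \<nu> \<and> young_diagram \<nu> \<in> \<Y>}"
  using finite_vimage_IntI[OF assms inj_on_young_diagram] by (simp add: vimage_def Int_def conj_commute)

lemma finite_upper: "is_int_partition \<mu> \<Longrightarrow> finite (upper \<mu>)"
  unfolding upper_eq
  by (intro finite_partitions_with_diagram finite.insertI finite_imageI)
    (simp add: card_addable diagram_young_diagram)

lemma finite_lower: "is_int_partition \<nu> \<Longrightarrow> finite (lower \<nu>)"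
  unfolding lower_eq
  by (intro finite_partitions_with_diagram finite.insertI finite_imageI)
    (simp add: finite_removable diagram_young_diagram)

text \<open>The last two entries of a tableau record its final two half-steps; the entries before
  them form a tableau with one level less, ending in some \<rho>.\<close>

lemma vacillating_tableaux_Suc:
  assumes "is_int_partition \<nu>"
  shows "vacillating_tableaux (Suc k) \<nu> =
    (\<Union>\<mu> \<in> lower \<nu>. \<Union>\<rho> \<in> upper \<mu>. (\<lambda>T. T @ [\<mu>, \<nu>]) ` vacillating_tableaux k \<rho>)"
    (is "?L = ?R")
proof (intro equalityI subsetI)
  fix T assume "T \<in> ?L"
  then have len: "length T = 2 * k + 3" and int: "\<forall>\<mu> \<in> set T. is_int_partition \<mu>"
    and ends: "T ! 0 = []" "T ! (2 * k + 2) = \<nu>"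
    and steps: "\<And>i. i < Suc k \<Longrightarrow>
      (T ! (2 * i + 1) = T ! (2 * i) \<or> removes_box (T ! (2 * i)) (T ! (2 * i + 1))) \<and>
      (T ! (2 * i + 2) = T ! (2 * i + 1) \<or> adds_box (T ! (2 * i + 1)) (T ! (2 * i + 2)))"
    by (simp_all add: vacillating_tableaux_def)
  let ?S = "take (2 * k + 1) T" and ?\<rho> = "T ! (2 * k)" and ?\<mu> = "T ! (2 * k + 1)"
  have "?S \<in> vacillating_tableaux k ?\<rho>"
    using len int ends steps by (auto simp: vacillating_tableaux_def dest: in_set_takeD)
  moreover have "T = ?S @ [?\<mu>, \<nu>]"
  proof (rule nth_equalityI)
    fix i assume "i < length T"
    then have "i < 2 * k + 1 \<or> i = 2 * k + 1 \<or> i = 2 * k + 2" using len by linarith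
    then show "T ! i = (?S @ [?\<mu>, \<nu>]) ! i" using len ends by (auto simp: nth_append)
  qed (simp add: len)
  moreover have "?\<rho> \<in> upper ?\<mu>" "?\<mu> \<in> lower \<nu>"
    using steps[of k] int len ends by (auto simp: upper_def lower_def)
  ultimately show "T \<in> ?R" by blast
next
  fix T assume "T \<in> ?R"
  then obtain \<mu> \<rho> S where T: "T = S @ [\<mu>, \<nu>]" and S: "S \<in> vacillating_tableaux k \<rho>"
    and \<mu>: "\<mu> \<in> lower \<nu>" and \<rho>: "\<rho> \<in> upper \<mu>" by blast
  have len: "length S = 2 * k + 1" using S by (simp add: vacillating_tableaux_def)
  have nth: "T ! i = S ! i" if "i \<le> 2 * k" for i using that len by (simp add: T nth_append)
  have nth': "T ! (2 * k + 1) = \<mu>" "T ! (2 * k + 2) = \<nu>" using len by (simp_all add: T nth_append)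
  have "(T ! (2 * i + 1) = T ! (2 * i) \<or> removes_box (T ! (2 * i)) (T ! (2 * i + 1))) \<and>
      (T ! (2 * i + 2) = T ! (2 * i + 1) \<or> adds_box (T ! (2 * i + 1)) (T ! (2 * i + 2)))"
    if "i < Suc k" for i
  proof (cases "i = k")
    case True
    have "S ! (2 * k) = \<rho>" using S by (simp add: vacillating_tableaux_def)
    then show ?thesis using \<mu> \<rho> nth[of "2 * k"] nth' True by (auto simp: upper_def lower_def)
  next
    case False
    then show ?thesis using S that by (simp add: nth vacillating_tableaux_def)
  qed
  then show "T \<in> ?L"
    using S \<mu> assms nth[of 0] nth' len
    by (auto simp: vacillating_tableaux_def T lower_def)
qed

text \<open>The unions are disjoint, because \<mu> is read off the appended pair and \<rho> off the
  end of the prefix. Finiteness is carried along since \<open>card\<close> gives \<open>0\<close> on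
  infinite sets.\<close>

lemma num_vacillating_Suc:
  assumes \<nu>: "is_int_partition \<nu>"
    and fin: "\<And>\<rho>. is_int_partition \<rho> \<Longrightarrow> finite (vacillating_tableaux k \<rho>)"
  shows "finite (vacillating_tableaux (Suc k) \<nu>)"
    and "num_vacillating (Suc k) \<nu> = (\<Sum>\<mu> \<in> lower \<nu>. \<Sum>\<rho> \<in> upper \<mu>. num_vacillating k \<rho>)"
proof -
  let ?V = "\<lambda>\<mu> \<rho>. (\<lambda>T. T @ [\<mu>, \<nu>]) ` vacillating_tableaux k \<rho>"
  have low: "is_int_partition \<mu>" if "\<mu> \<in> lower \<nu>" for \<mu> using that by (simp add: lower_def)
  have up: "is_int_partition \<rho>" if "\<rho> \<in> upper \<mu>" for \<rho> \<mu> using that by (simp add: upper_def)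
  have finV: "finite (?V \<mu> \<rho>)" if "\<rho> \<in> upper \<mu>" for \<mu> \<rho> using fin up that by blast
  have finU: "finite (\<Union>\<rho> \<in> upper \<mu>. ?V \<mu> \<rho>)" if "\<mu> \<in> lower \<nu>" for \<mu>
    using finite_upper[OF low[OF that]] finV by blast
  show "finite (vacillating_tableaux (Suc k) \<nu>)"
    unfolding vacillating_tableaux_Suc[OF \<nu>] using finite_lower[OF \<nu>] finU by blast
  have "num_vacillating (Suc k) \<nu> = (\<Sum>\<mu> \<in> lower \<nu>. card (\<Union>\<rho> \<in> upper \<mu>. ?V \<mu> \<rho>))"
    unfolding num_vacillating_def vacillating_tableaux_Suc[OF \<nu>]
    using finite_lower[OF \<nu>] finU by (intro card_UN_disjoint) auto
  also have "\<dots> = (\<Sum>\<mu> \<in> lower \<nu>. \<Sum>\<rho> \<in> upper \<mu>. card (?V \<mu> \<rho>))"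
  proof (intro sum.cong refl card_UN_disjoint)
    fix \<mu> assume "\<mu> \<in> lower \<nu>"
    then show "finite (upper \<mu>)" by (simp add: finite_upper low)
    show "\<forall>\<rho> \<in> upper \<mu>. finite (?V \<mu> \<rho>)" using finV by blast
    show "\<forall>\<rho> \<in> upper \<mu>. \<forall>\<rho>' \<in> upper \<mu>. \<rho> \<noteq> \<rho>' \<longrightarrow> ?V \<mu> \<rho> \<inter> ?V \<mu> \<rho>' = {}"
      by (auto simp: vacillating_tableaux_def)
  qed
  also have "\<dots> = (\<Sum>\<mu> \<in> lower \<nu>. \<Sum>\<rho> \<in> upper \<mu>. num_vacillating k \<rho>)"
    unfolding num_vacillating_def by (intro sum.cong refl card_image inj_onI) auto
  finally show "num_vacillating (Suc k) \<nu> = (\<Sum>\<mu> \<in> lower \<nu>. \<Sum>\<rho> \<in> upper \<mu>. num_vacillating k \<rho>)" .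
qed

text \<open>The induction step applies \<open>1 + D\<close> and then \<open>1 + U\<close> to the
  coefficient function of the combination of the \<open>U^t\<close> with weights
  \<open>W(k,t)\<close>.\<close>

lemma num_vacillating_eq:
  assumes "is_int_partition \<nu>"
  shows "finite (vacillating_tableaux k \<nu>) \<and>
    num_vacillating k \<nu> = marked_partitions k (sum_list \<nu>) * num_SYT (sum_list \<nu>) (young_diagram \<nu>)"
  using assms
proof (induction k arbitrary: \<nu>)
  case 0
  have "vacillating_tableaux 0 \<nu> = (if \<nu> = [] then {[[]]} else {})"
    by (auto simp: vacillating_tableaux_def is_int_partition_def length_Suc_conv)
  moreover have "sum_list \<nu> = 0 \<longleftrightarrow> \<nu> = []"
    using 0 by (cases \<nu>) (auto simp: is_int_partition_def)
  ultimately show ?case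
    by (auto simp: num_vacillating_def marked_partitions_0 young_diagram_def)
next
  case (Suc k)
  note IH = Suc.IH
  \<comment> \<open>The weight of \<open>U^n\<close> after the factor \<open>1 + D\<close>: the term
    \<open>U^(n+1)\<close> contributes \<open>n + 1\<close> times its own weight.\<close>
  define h where "h n = marked_partitions k n + Suc n * marked_partitions k (Suc n)" for n
  have up: "(\<Sum>\<rho> \<in> upper \<mu>. num_vacillating k \<rho>) =
      h (card (young_diagram \<mu>)) * num_SYT (card (young_diagram \<mu>)) (young_diagram \<mu>)"
    if \<mu>: "is_int_partition \<mu>" for \<mu>
  proof -
    let ?Y = "young_diagram \<mu>"
    let ?g = "\<lambda>Y. marked_partitions k (card Y) * num_SYT (card Y) Y"
    have Y: "diagram ?Y" by (rule diagram_young_diagram[OF \<mu>])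
    have "(\<Sum>\<rho> \<in> upper \<mu>. num_vacillating k \<rho>) = (\<Sum>\<rho> \<in> upper \<mu>. ?g (young_diagram \<rho>))"
      using IH by (intro sum.cong refl) (auto simp: upper_def card_young_diagram)
    also have "\<dots> = ?g ?Y + (\<Sum>b \<in> addable ?Y. ?g (insert b ?Y))"
      by (rule sum_upper[OF \<mu>])
    also have "(\<Sum>b \<in> addable ?Y. ?g (insert b ?Y)) =
        (\<Sum>b \<in> addable ?Y. marked_partitions k (Suc (card ?Y)) * num_SYT (Suc (card ?Y)) (insert b ?Y))"
      using Y by (intro sum.cong refl) (simp add: addable_def diagram_def)
    also have "\<dots> = marked_partitions k (Suc (card ?Y)) * (Suc (card ?Y) * num_SYT (card ?Y) ?Y)"
      by (simp only: sum_num_SYT_addable[OF Y] flip: sum_distrib_left)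
    finally show ?thesis by (simp add: h_def algebra_simps)
  qed
  let ?Y = "young_diagram \<nu>"
  let ?g = "\<lambda>Y. h (card Y) * num_SYT (card Y) Y"
  have Y: "diagram ?Y" by (rule diagram_young_diagram[OF Suc.prems])
  have "num_vacillating (Suc k) \<nu> = (\<Sum>\<mu> \<in> lower \<nu>. \<Sum>\<rho> \<in> upper \<mu>. num_vacillating k \<rho>)"
    using IH Suc.prems by (intro num_vacillating_Suc) blast+
  also have "\<dots> = (\<Sum>\<mu> \<in> lower \<nu>. ?g (young_diagram \<mu>))"
    using up by (intro sum.cong refl) (simp add: lower_def)
  also have "\<dots> = ?g ?Y + (\<Sum>c \<in> removable ?Y. ?g (?Y - {c}))"
    by (rule sum_lower[OF Suc.prems])
  \<comment> \<open>The factor \<open>1 + U\<close> adds \<open>h (n - 1)\<close> to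
    \<open>h n\<close>, which is the recursion for marked partitions. At \<open>n = 0\<close>
    nothing can be removed and only \<open>h 0\<close> remains.\<close>
  also have "\<dots> = marked_partitions (Suc k) (card ?Y) * num_SYT (card ?Y) ?Y"
  proof (cases "card ?Y")
    case 0
    then have "removable ?Y = {}" using Y by (auto simp: removable_def diagram_def)
    then show ?thesis using 0 by (simp add: h_def marked_partitions_Suc)
  next
    case (Suc n)
    have "(\<Sum>c \<in> removable ?Y. ?g (?Y - {c})) = (\<Sum>c \<in> removable ?Y. h n * num_SYT n (?Y - {c}))"
      using Suc by (intro sum.cong refl) (simp add: removable_def)
    also have "\<dots> = h n * num_SYT (Suc n) ?Y" by (simp add: sum_distrib_left)
    finally show ?thesis
      using Suc by (simp add: h_def marked_partitions_Suc algebra_simps del: num_SYT.simps)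
  qed
  finally show ?case
    using num_vacillating_Suc(1)[OF Suc.prems] IH by (simp add: card_young_diagram)
qed

theorem mainTheorem7:
  fixes k t :: nat
  assumes "k \<ge> 1" and "t \<le> k"
  shows "card {d \<in> partition_diagrams k. pn k d = t} =
    (\<Sum>\<nu> \<in> {\<nu> \<in> \<Gamma> k. sum_list \<nu> = t}. (num_vacillating k \<nu>)\<^sup>2)"
proof -
  \<comment> \<open>As \<open>t \<le> k\<close>, the size bound in \<open>\<Gamma> k\<close> is
    automatic, so all diagrams with \<open>t\<close> boxes occur.\<close>
  have "(\<Sum>\<nu> \<in> {\<nu> \<in> \<Gamma> k. sum_list \<nu> = t}. (num_vacillating k \<nu>)\<^sup>2) =
      (\<Sum>\<nu> | is_int_partition \<nu> \<and> young_diagram \<nu> \<in> diagrams t.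
        (marked_partitions k t * num_SYT t (young_diagram \<nu>))\<^sup>2)"
    using assms(2)
    by (intro sum.cong)
      (auto simp: \<Gamma>_def diagrams_def diagram_young_diagram card_young_diagram num_vacillating_eq)
  also have "\<dots> = (\<Sum>Y \<in> diagrams t. (marked_partitions k t * num_SYT t Y)\<^sup>2)"
    by (rule sum_young_diagram) (auto simp: diagrams_def)
  also have "\<dots> = (marked_partitions k t)\<^sup>2 * fact t"
    by (simp only: power_mult_distrib sum_num_SYT_squares flip: sum_distrib_left)
  finally show ?thesis by (simp add: card_partition_diagrams_pn)
qed

end
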